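(* Let $p$ be a positive integer. If $\mathcal{F}$ is a finite family of nonempty compact convex sets in $\mathbb{R}^2$ with the $(p+1,2)$ property, then $\mathcal{F}$ is pierced by $\lfloor \frac{p}{2}\rfloor+1$ lines.
   Context: For integers $m\ge q>0$, a family of sets has the $(m,q)$ property if among any $m$ (distinct) members of it some $q$ have a nonempty common intersection (the property holds vacuously if the family has fewer than $m$ members). A family $\mathcal{F}$ of sets in $\mathbb{R}^d$ is pierced by $k$ lines if there exist $k$ lines in $\mathbb{R}^d$ whose union intersects every set in $\mathcal{F}$. *)

theory Defs
  imports "HOL-Analysis.Analysis"
begin

text \<open>A family of sets is a set of sets, so its members are automatically distinct. The notion is
  intended for \<open>m \<ge> q > 0\<close>.\<close>

definition mq_property :: "nat \<Rightarrow> nat \<Rightarrow> 'a set set \<Rightarrow> bool" where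
  "mq_property m q \<F> \<longleftrightarrow>
     (\<forall>\<A>\<subseteq>\<F>. card \<A> = m \<longrightarrow> (\<exists>\<B>\<subseteq>\<A>. card \<B> = q \<and> \<Inter>\<B> \<noteq> {}))"

definition is_line :: "'a::euclidean_space set \<Rightarrow> bool" where
  "is_line l \<longleftrightarrow> affine l \<and> aff_dim l = 1"

text \<open>The condition \<open>finite L\<close> matters for \<open>k = 0\<close>, as \<open>card\<close> is 0 on infinite sets.\<close>

definition pierced_by_lines :: "nat \<Rightarrow> 'a::euclidean_space set set \<Rightarrow> bool" where
  "pierced_by_lines k \<F> \<longleftrightarrow>
     (\<exists>L. finite L \<and> card L = k \<and> (\<forall>l\<in>L. is_line l) \<and> (\<forall>S\<in>\<F>. S \<inter> \<Union>L \<noteq> {}))"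

end

theory Submission
  imports Defs
begin

text \<open>Let \<open>k = p div 2 + 1\<close>, so that no \<open>2 * k\<close> members of \<open>\<F>\<close> are pairwise disjoint. Sweep a line in a
  fixed direction, stopping when the closed half-plane behind it first contains \<open>k\<close> pairwise
  disjoint members. Then each open side of this line contains at most \<open>k - 1\<close> pairwise disjoint
  members. It remains to see that two families \<open>A\<close>, \<open>B\<close> on opposite sides of a line, each with at
  most \<open>m\<close> pairwise disjoint members, are pierced by \<open>m\<close> common lines. For a unit vector \<open>u\<close>, sweep
  in direction \<open>u\<close> until a first member of \<open>A\<close> lies behind the line, and likewise for \<open>B\<close>.
  Which family comes first is reversed between the two normals of the separating line, so for
  some \<open>u\<close> both are reached simultaneously. The line found there meets every member not strictly in
  front of it, and the members strictly in front are disjoint from the ones just reached, so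
  \<open>m\<close> drops by one for both families.\<close>

section \<open>Support functions of compact sets\<close>

definition support_fun :: "'a::euclidean_space set \<Rightarrow> 'a \<Rightarrow> real" where
  "support_fun S u = (SUP x\<in>S. u \<bullet> x)"

lemma support_fun_upper:
  assumes "compact S" "x \<in> S"
  shows "u \<bullet> x \<le> support_fun S u"
proof -
  have "compact ((\<lambda>x. u \<bullet> x) ` S)"
    by (intro compact_continuous_image continuous_intros assms)
  then show ?thesis
    unfolding support_fun_def
    by (intro cSUP_upper assms bounded_imp_bdd_above compact_imp_bounded)
qed

lemma support_fun_attained:
  assumes "compact S" "S \<noteq> {}"
  obtains x where "x \<in> S" "u \<bullet> x = support_fun S u"
proof -
  have "continuous_on S (\<lambda>x. u \<bullet> x)"
    by (intro continuous_intros)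
  from continuous_attains_sup[OF assms this]
  obtain x where x: "x \<in> S" "\<forall>y\<in>S. u \<bullet> y \<le> u \<bullet> x" by auto
  have "support_fun S u \<le> u \<bullet> x"
    unfolding support_fun_def using x assms by (intro cSUP_least) auto
  with support_fun_upper[OF assms(1) x(1), of u] x that show thesis by force
qed

lemma support_fun_le_iff:
  assumes "compact S" "S \<noteq> {}"
  shows "support_fun S u \<le> t \<longleftrightarrow> (\<forall>x\<in>S. u \<bullet> x \<le> t)"
  using support_fun_upper[OF assms(1)] support_fun_attained[OF assms, of u]
  by (metis order_trans)

lemma le_support_fun_iff:
  assumes "compact S" "S \<noteq> {}"
  shows "t \<le> support_fun S u \<longleftrightarrow> (\<exists>x\<in>S. t \<le> u \<bullet> x)"
  using support_fun_upper[OF assms(1)] support_fun_attained[OF assms, of u]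
  by (metis order_trans order_refl)

text \<open>If all points of \<open>S\<close> have norm at most \<open>R\<close>, then by
  Cauchy-Schwarz replacing \<open>u\<close> by \<open>v\<close> changes each
  \<open>u \<bullet> x\<close> by at most \<open>R * dist u v\<close>. Hence the support function is
  Lipschitz with constant \<open>R\<close>.\<close>

lemma support_fun_continuous:
  assumes "compact S" "S \<noteq> {}"
  shows "continuous_on U (support_fun S)"
proof -
  obtain R where R: "R > 0" "\<And>x. x \<in> S \<Longrightarrow> norm x \<le> R"
    using compact_imp_bounded[OF assms(1)] bounded_pos by metis
  have le: "support_fun S u \<le> support_fun S v + R * dist u v" for u v
  proof -
    obtain x where x: "x \<in> S" "u \<bullet> x = support_fun S u"
      using support_fun_attained[OF assms] by blast
    have "u \<bullet> x - v \<bullet> x \<le> dist u v * norm x"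
      using norm_cauchy_schwarz[of "u - v" x] by (simp add: dist_norm inner_diff_left)
    also have "\<dots> \<le> R * dist u v"
      using R(2)[OF x(1)] by (simp add: mult.commute[of R] mult_left_mono)
    finally show ?thesis
      using x support_fun_upper[OF assms(1) x(1), of v] by linarith
  qed
  have "dist (support_fun S u) (support_fun S v) \<le> R * dist u v" for u v
    using le[of u v] le[of v u] by (simp add: dist_real_def dist_commute abs_le_iff)
  then have "R-lipschitz_on U (support_fun S)"
    using R by (intro lipschitz_onI) auto
  then show ?thesis by (rule lipschitz_on_continuous_on)
qed

lemma continuous_on_Min_image:
  fixes f :: "'i \<Rightarrow> 'a::topological_space \<Rightarrow> 'b::linorder_topology"
  assumes "finite A" "A \<noteq> {}" "\<And>i. i \<in> A \<Longrightarrow> continuous_on U (f i)"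
  shows "continuous_on U (\<lambda>x. Min ((\<lambda>i. f i x) ` A))"
  using assms by (induction A rule: finite_ne_induct) (auto intro!: continuous_on_min)

section \<open>Packing numbers: sizes of pairwise disjoint subfamilies\<close>

definition packing_le :: "nat \<Rightarrow> 'a set set \<Rightarrow> bool" where
  "packing_le m \<F> \<longleftrightarrow> (\<forall>\<A>\<subseteq>\<F>. pairwise disjnt \<A> \<longrightarrow> card \<A> \<le> m)"

lemma packing_le_subset: "packing_le m \<F> \<Longrightarrow> \<G> \<subseteq> \<F> \<Longrightarrow> packing_le m \<G>"
  unfolding packing_le_def by blast

lemma packing_le_mono: "packing_le m \<F> \<Longrightarrow> m \<le> n \<Longrightarrow> packing_le n \<F>"
  unfolding packing_le_def by (meson order_trans)

lemma packing_le_empty [simp]: "packing_le m {}"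
  by (simp add: packing_le_def)

lemma packing_le_0:
  assumes "finite \<F>" "packing_le 0 \<F>"
  shows "\<F> = {}"
proof (rule ccontr)
  assume "\<F> \<noteq> {}"
  then obtain S where "S \<in> \<F>" by auto
  then have "card {S} \<le> 0"
    using assms(2) unfolding packing_le_def by (metis empty_subsetI insert_subset pairwise_singleton)
  then show False by simp
qed

text \<open>A packing in \<A> and a packing in \<B> together form a packing in \<F>. They share no
  member, since such a member would be disjoint from itself and hence empty. With at least
  \<open>m + 1\<close> members in the first packing, at most \<open>n\<close> remain for the
  second.\<close>

lemma packing_le_split:
  assumes fin: "finite \<F>" and pack: "packing_le (m + n + 1) \<F>"
    and sub: "\<A> \<subseteq> \<F>" "\<B> \<subseteq> \<F>"
    and disj: "\<And>S T. S \<in> \<A> \<Longrightarrow> T \<in> \<B> \<Longrightarrow> disjnt S T"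
    and ne: "{} \<notin> \<F>" and A: "\<not> packing_le m \<A>"
  shows "packing_le n \<B>"
  unfolding packing_le_def
proof (intro allI impI)
  fix \<D> assume D: "\<D> \<subseteq> \<B>" "pairwise disjnt \<D>"
  obtain \<C> where C: "\<C> \<subseteq> \<A>" "pairwise disjnt \<C>" "m < card \<C>"
    using A unfolding packing_le_def by (meson not_le)
  have CD: "\<C> \<inter> \<D> = {}"
  proof (rule ccontr)
    assume "\<C> \<inter> \<D> \<noteq> {}"
    then obtain S where "S \<in> \<C>" "S \<in> \<D>" by auto
    then have "S = {}" "S \<in> \<F>" using disj[of S S] C D sub by (auto simp: disjnt_def)
    then show False using ne by simp
  qed
  have "pairwise disjnt (\<C> \<union> \<D>)"
    using C D disj unfolding pairwise_def by (metis Un_iff disjnt_sym subsetD)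
  then have "card (\<C> \<union> \<D>) \<le> m + n + 1"
    using pack C D sub unfolding packing_le_def by (meson Un_least order_trans)
  moreover have "card (\<C> \<union> \<D>) = card \<C> + card \<D>"
    using C D sub fin CD by (meson card_Un_disjoint finite_subset)
  ultimately show "card \<D> \<le> n" using C by linarith
qed

lemma mq_property_2_imp_packing_le:
  assumes "mq_property (p + 1) 2 \<F>" "finite \<F>"
  shows "packing_le p \<F>"
  unfolding packing_le_def
proof (intro allI impI)
  fix \<A> assume A: "\<A> \<subseteq> \<F>" "pairwise disjnt \<A>"
  show "card \<A> \<le> p"
  proof (rule ccontr)
    assume "\<not> card \<A> \<le> p"
    then obtain \<C> where C: "\<C> \<subseteq> \<A>" "card \<C> = p + 1"
      using obtain_subset_with_card_n[of "p + 1" \<A>] by auto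
    then obtain \<B> where B: "\<B> \<subseteq> \<C>" "card \<B> = 2" "\<Inter>\<B> \<noteq> {}"
      using assms A unfolding mq_property_def by (meson order_trans)
    then obtain S T where ST: "\<B> = {S, T}" "S \<noteq> T" by (meson card_2_iff)
    then have "S \<in> \<A>" "T \<in> \<A>" using B(1) C(1) by auto
    then have "disjnt S T" using A(2) ST(2) by (simp add: pairwiseD)
    then show False using B ST by (simp add: disjnt_def)
  qed
qed

section \<open>Piercing by at most \<open>k\<close> hyperplanes\<close>

definition pierced_by_hyperplanes :: "nat \<Rightarrow> 'a::euclidean_space set set \<Rightarrow> bool" where
  "pierced_by_hyperplanes k \<F> \<longleftrightarrow>
     (\<exists>H. finite H \<and> card H \<le> k \<and> (\<forall>h\<in>H. \<exists>u t. u \<noteq> 0 \<and> h = {x. u \<bullet> x = t}) \<and>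
          (\<forall>S\<in>\<F>. S \<inter> \<Union>H \<noteq> {}))"

lemma pierced_by_hyperplanes_mono:
  "pierced_by_hyperplanes k \<F> \<Longrightarrow> k \<le> l \<Longrightarrow> pierced_by_hyperplanes l \<F>"
  unfolding pierced_by_hyperplanes_def by (meson order_trans)

lemma pierced_by_hyperplanes_Suc:
  assumes "pierced_by_hyperplanes k \<G>" "u \<noteq> 0"
    and "\<And>S. S \<in> \<F> \<Longrightarrow> S \<notin> \<G> \<Longrightarrow> S \<inter> {x. u \<bullet> x = t} \<noteq> {}"
  shows "pierced_by_hyperplanes (Suc k) \<F>"
proof -
  obtain H where H: "finite H" "card H \<le> k" "\<forall>h\<in>H. \<exists>u t. u \<noteq> 0 \<and> h = {x. u \<bullet> x = t}"
      "\<forall>S\<in>\<G>. S \<inter> \<Union>H \<noteq> {}"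
    using assms(1) unfolding pierced_by_hyperplanes_def by blast
  let ?H = "insert {x. u \<bullet> x = t} H"
  \<comment> \<open>The new hyperplane may already belong to \<open>H\<close>, so only an upper
    bound on the number of hyperplanes survives the induction.\<close>
  have "card ?H \<le> Suc k"
    using H by (simp add: card_insert_if)
  moreover have "\<forall>S\<in>\<F>. S \<inter> \<Union>?H \<noteq> {}"
    using H(4) assms(3) by blast
  moreover have "\<forall>h\<in>?H. \<exists>u t. u \<noteq> 0 \<and> h = {x. u \<bullet> x = t}"
    using H(3) assms(2) by blast
  ultimately show ?thesis
    unfolding pierced_by_hyperplanes_def using H(1) by (intro exI[of _ ?H]) blast
qed

text \<open>The last two assumptions provide a point of \<open>S\<close> on or in front of the
  hyperplane and one on or behind it, so the intermediate value theorem applies. Convexity enters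
  the argument only through connectedness.\<close>

lemma connected_meets_hyperplane:
  assumes "compact S" "connected S" "S \<noteq> {}" "t \<le> support_fun S u" "\<not> (\<forall>x\<in>S. t < u \<bullet> x)"
  shows "S \<inter> {x. u \<bullet> x = t} \<noteq> {}"
proof -
  obtain x y where "x \<in> S" "t \<le> u \<bullet> x" "y \<in> S" "u \<bullet> y \<le> t"
    using assms le_support_fun_iff[OF assms(1,3), of t u] by force
  then show ?thesis
    using connected_ivt_hyperplane[OF assms(2), of y x u t] by blast
qed

section \<open>Two families separated by a hyperplane\<close>

lemma simultaneous_first_contact:
  fixes A B :: "'a::euclidean_space set set"
  assumes dim: "2 \<le> DIM('a)" and fin: "finite A" "finite B" and ne: "A \<noteq> {}" "B \<noteq> {}"
    and sets: "\<And>S. S \<in> A \<union> B \<Longrightarrow> compact S \<and> S \<noteq> {}"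
    and v: "norm v = 1"
    and AB: "\<forall>S\<in>A. \<forall>x\<in>S. c \<le> v \<bullet> x" "\<forall>S\<in>B. \<forall>x\<in>S. v \<bullet> x \<le> c"
  obtains u where "norm u = 1"
    "Min ((\<lambda>S. support_fun S u) ` A) = Min ((\<lambda>S. support_fun S u) ` B)"
proof -
  \<comment> \<open>For finite nonempty \<open>D\<close>, this is the least \<open>t\<close> for
    which the half-space \<open>u \<bullet> x \<le> t\<close> contains a whole member of
    \<open>D\<close>.\<close>
  define f where "f D u = Min ((\<lambda>S. support_fun S u) ` D)" for D and u :: 'a
  have cont: "continuous_on (sphere 0 1) (\<lambda>u. f A u - f B u)"
    unfolding f_def using fin ne sets
    by (intro continuous_on_diff continuous_on_Min_image support_fun_continuous) auto
  have ge: "c \<le> f D w"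
    if D: "finite D" "D \<noteq> {}" "D \<subseteq> A \<union> B" "\<forall>S\<in>D. \<forall>x\<in>S. c \<le> w \<bullet> x" for D w c
  proof -
    have "c \<le> support_fun S w" if "S \<in> D" for S
    proof -
      have S: "compact S" "S \<noteq> {}" using that D(3) sets by auto
      then show ?thesis using le_support_fun_iff[OF S] D(4) that by blast
    qed
    then show ?thesis unfolding f_def using D(1,2) by simp
  qed
  have le: "f D w \<le> c"
    if D: "finite D" "D \<noteq> {}" "D \<subseteq> A \<union> B" "\<forall>S\<in>D. \<forall>x\<in>S. w \<bullet> x \<le> c" for D w c
  proof -
    obtain S where S: "S \<in> D" using D(2) by blast
    then have "compact S" "S \<noteq> {}" using D(3) sets by auto
    then have "support_fun S w \<le> c" using support_fun_le_iff D(4) S by blast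
    moreover have "f D w \<le> support_fun S w" unfolding f_def using D(1) S by (intro Min_le) auto
    ultimately show ?thesis by simp
  qed
  \<comment> \<open>In direction \<open>v\<close> the family \<open>B\<close> is reached no later
    than \<open>A\<close>; in direction \<open>- v\<close> the order is reversed.\<close>
  have "f B v \<le> c" "c \<le> f A v" "f A (- v) \<le> - c" "- c \<le> f B (- v)"
    using fin ne AB by (auto intro!: ge le)
  then have zero: "0 \<in> {f A (- v) - f B (- v)..f A v - f B v}" by simp
  \<comment> \<open>The unit sphere is connected because the dimension is at least 2, so the
    difference takes the value 0 somewhere between \<open>- v\<close> and \<open>v\<close>.\<close>
  have "connected ((\<lambda>u. f A u - f B u) ` sphere 0 1)"
    by (intro connected_continuous_image cont connected_sphere dim)
  then have "{f A (- v) - f B (- v)..f A v - f B v} \<subseteq> (\<lambda>u. f A u - f B u) ` sphere 0 1"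
    by (rule connected_contains_Icc) (use v in auto)
  with zero have "0 \<in> (\<lambda>u. f A u - f B u) ` sphere 0 1" by (rule rev_subsetD)
  then obtain u where "norm u = 1" "f A u = f B u" by auto
  with that show thesis unfolding f_def by blast
qed

lemma first_contact:
  fixes A B :: "'a::euclidean_space set set"
  assumes dim: "2 \<le> DIM('a)" and fin: "finite A" "finite B"
    and sets: "\<And>S. S \<in> A \<union> B \<Longrightarrow> compact S \<and> S \<noteq> {}"
    and v: "norm v = 1"
    and AB: "\<forall>S\<in>A. \<forall>x\<in>S. c \<le> v \<bullet> x" "\<forall>S\<in>B. \<forall>x\<in>S. v \<bullet> x \<le> c"
  obtains u t where "norm u = 1" "\<And>S. S \<in> A \<union> B \<Longrightarrow> t \<le> support_fun S u"
    "A \<noteq> {} \<Longrightarrow> \<exists>S\<in>A. support_fun S u = t" "B \<noteq> {} \<Longrightarrow> \<exists>S\<in>B. support_fun S u = t"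
proof -
  define f where "f D u = Min ((\<lambda>S. support_fun S u) ` D)" for D and u :: 'a
  have f_le: "f D u \<le> support_fun S u" if "S \<in> D" "finite D" for D S u
    unfolding f_def using that by (intro Min_le) auto
  have f_eq: "\<exists>S\<in>D. support_fun S u = f D u" if "D \<noteq> {}" "finite D" for D u
  proof -
    have "f D u \<in> (\<lambda>S. support_fun S u) ` D" unfolding f_def using that by (intro Min_in) auto
    then show ?thesis by auto
  qed
  consider "A = {}" | "B = {}" | "A \<noteq> {}" "B \<noteq> {}" by blast
  then show thesis
  proof cases
    case 1
    then show thesis using that[of v "f B v"] v f_le[of _ B] f_eq[of B] fin by simp
  next
    case 2
    then show thesis using that[of v "f A v"] v f_le[of _ A] f_eq[of A] fin by simp
  next
    case 3
    obtain u where u: "norm u = 1" "f A u = f B u"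
      unfolding f_def
      using simultaneous_first_contact[OF dim fin 3 sets v AB] by blast
    show thesis
    proof (rule that[of u "f A u"])
      show "f A u \<le> support_fun S u" if "S \<in> A \<union> B" for S
        using that f_le[of S A u] f_le[of S B u] fin u(2) by auto
    qed (use u f_eq[of A u] f_eq[of B u] fin in auto)
  qed
qed

text \<open>A member with support value \<open>t\<close> lies in the half-space
  \<open>u \<bullet> x \<le> t\<close>, so it is disjoint from all members strictly in front and
  extends any packing of them by one.\<close>

lemma packing_le_in_front:
  assumes "finite A" "packing_le (Suc m) A"
    and sets: "\<And>S. S \<in> A \<Longrightarrow> compact S \<and> S \<noteq> {}"
    and "A \<noteq> {} \<Longrightarrow> \<exists>S\<in>A. support_fun S u = t"
  shows "packing_le m {S \<in> A. \<forall>x\<in>S. t < u \<bullet> x}"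
proof (cases "A = {}")
  case False
  then obtain S0 where S0: "S0 \<in> A" "support_fun S0 u = t" using assms(4) by blast
  show ?thesis
  proof (rule packing_le_split[OF assms(1), where m = 0 and \<A> = "{S0}"])
    show "\<not> packing_le 0 {S0}" using packing_le_0[of "{S0}"] by auto
    show "disjnt S T" if "S \<in> {S0}" "T \<in> {S \<in> A. \<forall>x\<in>S. t < u \<bullet> x}" for S T
      using that S0 sets[OF S0(1)] support_fun_upper[of S0 _ u] by (fastforce simp: disjnt_iff)
  qed (use assms S0 in auto)
qed simp

text \<open>Each hyperplane lowers the packing bound of both families at once, so \<open>m\<close>
  hyperplanes suffice rather than \<open>2 * m\<close>. The separation by \<open>v\<close> and
  \<open>c\<close> is inherited by subfamilies, so only \<open>A\<close> and \<open>B\<close> vary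
  in the induction.\<close>

lemma separated_pierced_by_hyperplanes:
  fixes A B :: "'a::euclidean_space set set"
  assumes dim: "2 \<le> DIM('a)" and "finite A" "finite B"
    and "\<And>S. S \<in> A \<union> B \<Longrightarrow> compact S \<and> connected S \<and> S \<noteq> {}"
    and v: "norm v = 1"
    and "\<forall>S\<in>A. \<forall>x\<in>S. c \<le> v \<bullet> x" "\<forall>S\<in>B. \<forall>x\<in>S. v \<bullet> x \<le> c"
    and "packing_le m A" "packing_le m B"
  shows "pierced_by_hyperplanes m (A \<union> B)"
  using assms(2-4,6-)
proof (induction m arbitrary: A B)
  case 0
  then have "A \<union> B = {}" using packing_le_0 by blast
  then show ?case unfolding pierced_by_hyperplanes_def by (intro exI[of _ "{}"]) auto
next
  case (Suc m)
  note fin = Suc.prems(1,2) and sets = Suc.prems(3) and AB = Suc.prems(4,5)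
  have cs: "compact S \<and> S \<noteq> {}" if "S \<in> A \<union> B" for S using sets that by blast
  obtain u t where u: "norm u = 1" and t: "\<And>S. S \<in> A \<union> B \<Longrightarrow> t \<le> support_fun S u"
    and contact: "A \<noteq> {} \<Longrightarrow> \<exists>S\<in>A. support_fun S u = t"
      "B \<noteq> {} \<Longrightarrow> \<exists>S\<in>B. support_fun S u = t"
    using first_contact[OF dim fin cs v AB] by blast
  define front where "front D = {S \<in> D. \<forall>x\<in>S. t < u \<bullet> x}" for D
  have "pierced_by_hyperplanes m (front A \<union> front B)"
  proof (rule Suc.IH)
    show "packing_le m (front A)" "packing_le m (front B)"
      unfolding front_def using cs
      by (auto intro!: packing_le_in_front fin Suc.prems contact)
  qed (use fin sets AB in \<open>auto simp: front_def\<close>)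
  then show ?case
  proof (rule pierced_by_hyperplanes_Suc)
    show "S \<inter> {x. u \<bullet> x = t} \<noteq> {}" if "S \<in> A \<union> B" "S \<notin> front A \<union> front B" for S
      using that sets[OF that(1)] t[OF that(1)]
      by (intro connected_meets_hyperplane) (auto simp: front_def)
  qed (use u in auto)
qed

section \<open>Choosing the separating hyperplane and combining\<close>

lemma balanced_threshold:
  assumes fin: "finite \<F>" and sets: "\<And>S. S \<in> \<F> \<Longrightarrow> compact S \<and> S \<noteq> {}"
    and pack: "packing_le (2 * m + 1) \<F>" and big: "\<not> packing_le m \<F>"
  obtains c where "packing_le m {S \<in> \<F>. support_fun S v < c}"
    "packing_le m {S \<in> \<F>. \<forall>x\<in>S. c < v \<bullet> x}"
proof -
  define h where "h S = support_fun S v" for S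
  \<comment> \<open>The candidate stopping positions: support values behind which more than
    \<open>m\<close> pairwise disjoint members lie. The sweep stops at the least of them.\<close>
  define C where "C = {c \<in> h ` \<F>. \<not> packing_le m {S \<in> \<F>. h S \<le> c}}"
  have below: "\<exists>c\<in>h ` \<G>. \<G> \<subseteq> {S \<in> \<F>. h S \<le> c}" if "\<G> \<subseteq> \<F>" "\<G> \<noteq> {}" for \<G>
    using that finite_subset[OF that(1) fin] by (intro bexI[of _ "Max (h ` \<G>)"]) auto
  have "finite C" using fin by (simp add: C_def)
  moreover have "\<F> \<noteq> {}" using big by auto
  then have "C \<noteq> {}"
    using below[of \<F>] big packing_le_subset unfolding C_def by blast
  ultimately have c: "Min C \<in> C" "\<And>d. d \<in> C \<Longrightarrow> Min C \<le> d" by auto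
  show thesis
  proof (rule that)
    let ?L = "{S \<in> \<F>. support_fun S v < Min C}"
    show "packing_le m ?L"
    proof (rule ccontr)
      assume L: "\<not> packing_le m ?L"
      then have "?L \<noteq> {}" by force
      \<comment> \<open>The largest support value \<open>d\<close> in \<open>?L\<close> would be a
        candidate below \<open>Min C\<close>.\<close>
      then obtain d where d: "d \<in> h ` ?L" "?L \<subseteq> {S \<in> \<F>. h S \<le> d}" using below[of ?L] by auto
      then have "d \<in> C" using L packing_le_subset unfolding C_def by blast
      moreover have "d < Min C" using d(1) by (auto simp: h_def)
      ultimately show False using c(2) by force
    qed
    show "packing_le m {S \<in> \<F>. \<forall>x\<in>S. Min C < v \<bullet> x}"
    \<comment> \<open>At least \<open>m + 1\<close> pairwise disjoint members lie behind the
      threshold, which leaves at most \<open>m\<close> of the \<open>2 * m + 1\<close> strictly in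
      front.\<close>
    proof (rule packing_le_split[OF fin])
      show "packing_le (m + m + 1) \<F>" using pack by (simp add: mult_2)
      show "\<not> packing_le m {S \<in> \<F>. h S \<le> Min C}" using c(1) by (simp add: C_def)
      show "disjnt S T"
        if "S \<in> {S \<in> \<F>. h S \<le> Min C}" "T \<in> {S \<in> \<F>. \<forall>x\<in>S. Min C < v \<bullet> x}" for S T
        using that sets support_fun_upper[of S _ v] by (fastforce simp: disjnt_iff h_def)
    qed (use sets in auto)
  qed
qed

theorem pierced_by_hyperplanes_if_packing_le:
  fixes \<F> :: "'a::euclidean_space set set"
  assumes dim: "2 \<le> DIM('a)" and fin: "finite \<F>"
    and sets: "\<And>S. S \<in> \<F> \<Longrightarrow> compact S \<and> connected S \<and> S \<noteq> {}"
    and pack: "packing_le (2 * m + 1) \<F>"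
  shows "pierced_by_hyperplanes (Suc m) \<F>"
proof -
  obtain v :: 'a where v: "norm v = 1" by (meson norm_Basis nonempty_Basis ex_in_conv)
  have cs: "compact S \<and> S \<noteq> {}" if "S \<in> \<F>" for S using sets that by blast
  show ?thesis
  proof (cases "packing_le m \<F>")
    case True
    \<comment> \<open>The sweep would never stop here, so the whole family is put on one side, with
      the empty family opposite. If \<F> is empty, the value of \<open>c\<close> is irrelevant, as
      there is no point to bound.\<close>
    define c where "c = Max ((\<lambda>S. support_fun S v) ` \<F>)"
    have c: "v \<bullet> x \<le> c" if "S \<in> \<F>" "x \<in> S" for S x
    proof -
      have "support_fun S v \<le> c" unfolding c_def using that fin by (intro Max_ge) auto
      then show ?thesis using support_fun_upper[of S x v] that sets by force
    qed
    have "pierced_by_hyperplanes m ({} \<union> \<F>)"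
      by (rule separated_pierced_by_hyperplanes[OF dim _ fin _ v, where c = c])
        (use sets c True in auto)
    then show ?thesis by (simp add: pierced_by_hyperplanes_mono)
  next
    case False
    obtain c where c: "packing_le m {S \<in> \<F>. support_fun S v < c}" (is "packing_le m ?L")
      "packing_le m {S \<in> \<F>. \<forall>x\<in>S. c < v \<bullet> x}" (is "packing_le m ?R")
      using balanced_threshold[OF fin cs pack False] by blast
    have "pierced_by_hyperplanes m (?R \<union> ?L)"
    proof (rule separated_pierced_by_hyperplanes[OF dim _ _ _ v, where c = c])
      show "\<forall>S\<in>?L. \<forall>x\<in>S. v \<bullet> x \<le> c"
        using sets support_fun_upper[of _ _ v] by fastforce
    qed (use fin sets c in \<open>auto intro: less_imp_le\<close>)
    then show ?thesis
    \<comment> \<open>The separating hyperplane itself is the additional one: it meets every member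
      that lies strictly on neither side.\<close>
    proof (rule pierced_by_hyperplanes_Suc)
      show "S \<inter> {x. v \<bullet> x = c} \<noteq> {}" if "S \<in> \<F>" "S \<notin> ?R \<union> ?L" for S
        using that sets[OF that(1)] by (intro connected_meets_hyperplane) auto
    qed (use v in auto)
  qed
qed

section \<open>From at most \<open>k\<close> hyperplanes to exactly \<open>k\<close> lines in the
  plane\<close>

lemma pierced_by_hyperplanes_imp_lines:
  fixes \<F> :: "'a::euclidean_space set set"
  assumes dim: "DIM('a) = 2" and "pierced_by_hyperplanes k \<F>"
  shows "pierced_by_lines k \<F>"
proof -
  obtain H where H: "finite H" "card H \<le> k" "\<forall>h\<in>H. \<exists>u t. u \<noteq> 0 \<and> h = {x. u \<bullet> x = t}"
      "\<forall>S\<in>\<F>. S \<inter> \<Union>H \<noteq> {}"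
    using assms(2) unfolding pierced_by_hyperplanes_def by blast
  have line: "is_line {x. u \<bullet> x = t}" if "u \<noteq> 0" for u :: 'a and t
    using that dim by (simp add: is_line_def affine_hyperplane)
  obtain v :: 'a where v: "norm v = 1" by (meson norm_Basis nonempty_Basis ex_in_conv)
  \<comment> \<open>An infinite supply of parallel lines, from which \<open>k - card H\<close> lines
    outside \<open>H\<close> are added to reach exactly \<open>k\<close>.\<close>
  define P where "P = range (\<lambda>t. {x. v \<bullet> x = t})"
  have "inj (\<lambda>t. {x. v \<bullet> x = t})"
  proof (rule injI)
    fix s t assume eq: "{x. v \<bullet> x = s} = {x. v \<bullet> x = t}"
    \<comment> \<open>The point \<open>s *\<^sub>R v\<close> tells the hyperplane at level
      \<open>s\<close> from all parallel ones.\<close>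
    have "v \<bullet> (s *\<^sub>R v) = s" using v by (simp add: norm_eq_1)
    then have "s *\<^sub>R v \<in> {x. v \<bullet> x = t}" unfolding eq[symmetric] by simp
    then show "s = t" using \<open>v \<bullet> (s *\<^sub>R v) = s\<close> by simp
  qed
  then have "infinite (P - H)"
    unfolding P_def using H(1) infinite_UNIV_char_0
    by (simp add: finite_image_iff)
  then obtain Q where Q: "Q \<subseteq> P - H" "finite Q" "card Q = k - card H"
    by (meson infinite_arbitrarily_large)
  have "card (H \<union> Q) = k"
    using H(1,2) Q by (subst card_Un_disjoint) auto
  moreover have "\<forall>l\<in>H \<union> Q. is_line l"
  proof
    fix l assume "l \<in> H \<union> Q"
    moreover have "\<exists>u t. u \<noteq> 0 \<and> l = {x. u \<bullet> x = t}" if "l \<in> Q"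
    proof -
      have "l \<in> P" using that Q(1) by auto
      then obtain t where "l = {x. v \<bullet> x = t}" by (auto simp: P_def)
      moreover have "v \<noteq> 0" using v by auto
      ultimately show ?thesis by auto
    qed
    ultimately have "\<exists>u t. u \<noteq> 0 \<and> l = {x. u \<bullet> x = t}" using H(3) by (metis Un_iff)
    then show "is_line l" using line by auto
  qed
  moreover have "\<forall>S\<in>\<F>. S \<inter> \<Union>(H \<union> Q) \<noteq> {}" using H(4) by blast
  ultimately show ?thesis
    unfolding pierced_by_lines_def using H(1) Q(2) by (intro exI[of _ "H \<union> Q"]) auto
qed

theorem theorem1p2:
  fixes p :: nat and \<F> :: "(real ^ 2) set set"
  assumes "p > 0"
    and "finite \<F>"
    and "\<And>S. S \<in> \<F> \<Longrightarrow> S \<noteq> {} \<and> compact S \<and> convex S"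
    and "mq_property (p + 1) 2 \<F>"
  shows "pierced_by_lines (p div 2 + 1) \<F>"
proof -
  have "packing_le p \<F>" using assms mq_property_2_imp_packing_le by blast
  \<comment> \<open>The new bound is \<open>p\<close> for odd \<open>p\<close> and
    \<open>p + 1\<close> for even \<open>p\<close>; this rounding yields the floor in the number of
    lines.\<close>
  then have "packing_le (2 * (p div 2) + 1) \<F>" by (rule packing_le_mono) presburger
  then have "pierced_by_hyperplanes (Suc (p div 2)) \<F>"
    using assms by (intro pierced_by_hyperplanes_if_packing_le) (auto simp: convex_connected)
  then show ?thesis
    by (intro pierced_by_hyperplanes_imp_lines) auto
qed

end
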